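(* Let $n$ and $s$ be integers for which $t=(n-3s+1)/2$ is a positive integer and $n\le 4s-3$, and let $T\subseteq[0,2t-1]$ be a set of integers. Then the set $S_T\subseteq\mathbb{Z}_n$ is sum-free if and only if \[2t-1\notin T+T+T,\] where the addition in $T+T+T$ is over the integers.
   Context: $\mathbb{Z}_n$ is the cyclic group of integers modulo $n$. For subsets $A,B$ of an abelian additive group $G$, $A+B=\{x+y \mid x\in A, y\in B\}$, $-A=\{-x \mid x\in A\}$, and $\pm A=A\cup(-A)$. A set $S\subseteq G$ is sum-free if $S\cap(S+S)=\emptyset$. For integers $a\le b$, $[a,b]=\{z\in\mathbb{Z} \mid a\le z\le b\}$; the same notation is used for the subset of $\mathbb{Z}_n$ represented by these integers. Definition of $S_T$: for integers $n,s$ such that $t=(n-3s+1)/2$ is a positive integer and $n\le 4s-3$, and a set of integers $T\subseteq[0,2t-1]$, $S_T\subseteq\mathbb{Z}_n$ is the set $S_T=[n-2s+1,2s-1]\cup\pm(s+T)$ (taken modulo $n$), where $s+T=\{s+x \mid x\in T\}$. *)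

theory Defs
  imports "HOL-Algebra.Elementary_Groups" "HOL-Library.Set_Algebras"
begin

text \<open>Groups are those of \<open>HOL-Algebra\<close>, whose operation is written multiplicatively:
  for an additive group \<open>G\<close>, the sumset \<open>A + B\<close> is \<open>A <#>\<^bsub>G\<^esub> B\<close> and \<open>-A\<close> is \<open>set_inv\<^bsub>G\<^esub> A\<close>.\<close>

definition sum_free :: "('a, 'b) monoid_scheme \<Rightarrow> 'a set \<Rightarrow> bool" where
  "sum_free G S \<longleftrightarrow> S \<subseteq> carrier G \<and> S \<inter> (S <#>\<^bsub>G\<^esub> S) = {}"

definition plus_minus :: "('a, 'b) monoid_scheme \<Rightarrow> 'a set \<Rightarrow> 'a set" where
  "plus_minus G A = A \<union> set_inv\<^bsub>G\<^esub> A"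

definition residues_of :: "int \<Rightarrow> int set \<Rightarrow> int set" where
  "residues_of n A = (\<lambda>z. z mod n) ` A"

text \<open>The set \<open>S\<^sub>T = [n - 2s + 1, 2s - 1] \<union> \<plusminus>(s + T)\<close>, as a subset of the carrier
  \<open>{0..<n}\<close> of \<open>integer_mod_group (nat n)\<close>. It is meant for \<open>n > 0\<close>, which follows from
  \<open>n - 3s + 1 > 0\<close> and \<open>n \<le> 4s - 3\<close>.\<close>

definition S_set :: "int \<Rightarrow> int \<Rightarrow> int set \<Rightarrow> int set" where
  "S_set n s T =
     residues_of n {n - 2 * s + 1..2 * s - 1} \<union>
     plus_minus (integer_mod_group (nat n)) (residues_of n (s +o T))"

end

theory Submission
  imports Defs
begin

text \<open>Put \<open>R = [n - 2s + 1, 2s - 1] \<union> (s + T) \<union> (n - (s + T))\<close>, a set of integers. Since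
  \<open>n = 3s + 2t - 1\<close> and \<open>T \<subseteq> [0, 2t - 1]\<close>, the three pieces lie in \<open>[n - 2s + 1, 2s - 1]\<close>,
  \<open>[s, n - 2s]\<close> and \<open>[2s, n - s]\<close>. So \<open>R\<close> consists of least residues, it represents \<open>S\<^sub>T\<close>, and it
  is invariant under the reflection \<open>x \<mapsto> n - x\<close>, which is negation in the group
  (\<open>S_set_eq_representatives\<close>).

  For a symmetric set, sum-freeness forbids exactly the triples with \<open>x + y + z \<equiv> 0\<close>. As
  \<open>R\<close> avoids \<open>0\<close>, the integer \<open>x + y + z\<close> is then \<open>n\<close> or \<open>2n\<close>, and reflecting all three summands
  exchanges these cases; so only \<open>x + y + z = n\<close> counts (\<open>sum_free_symmetric_iff\<close>). All elements of \<open>R\<close>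
  are at least \<open>s\<close>, so each summand of such a triple is at most \<open>n - 2s\<close> and hence lies in
  \<open>s + T\<close>. Writing the summands as \<open>s + a\<close>, \<open>s + b\<close>, \<open>s + c\<close>, the condition becomes
  \<open>a + b + c = n - 3s = 2t - 1\<close>.\<close>

text \<open>Symmetry turns a relation \<open>x + y \<equiv> z\<close> into \<open>x + y + (n - z) \<equiv> 0\<close>. For representatives
  strictly between \<open>0\<close> and \<open>n\<close>, the latter sum is \<open>n\<close> or \<open>2n\<close>; in the second case, the
  reflected triple has sum \<open>n\<close>.\<close>

lemma sum_free_symmetric_iff:
  fixes n :: int and R :: "int set"
  assumes range: "R \<subseteq> {0<..<n}"
    and sym: "\<And>x. x \<in> R \<Longrightarrow> n - x \<in> R"
  shows "sum_free (integer_mod_group (nat n)) R \<longleftrightarrow> (\<forall>x\<in>R. \<forall>y\<in>R. \<forall>z\<in>R. x + y + z \<noteq> n)"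
proof (cases "n > 0")
  case False
  then have "R = {}" using range by auto
  then show ?thesis by (simp add: sum_free_def)
next
  case True
  have "R \<subseteq> carrier (integer_mod_group (nat n))"
    using range True by (auto simp: carrier_integer_mod_group)
  then have "sum_free (integer_mod_group (nat n)) R \<longleftrightarrow> (\<forall>x\<in>R. \<forall>y\<in>R. (x + y) mod n \<notin> R)"
    using True by (auto simp: sum_free_def set_mult_def mult_integer_mod_group)
  also have "\<dots> \<longleftrightarrow> (\<forall>x\<in>R. \<forall>y\<in>R. \<forall>z\<in>R. x + y + z \<noteq> n)"
  proof (intro iffI ballI notI)
    fix x y z
    assume free: "\<forall>x\<in>R. \<forall>y\<in>R. (x + y) mod n \<notin> R"
      and mem: "x \<in> R" "y \<in> R" "z \<in> R" and sum: "x + y + z = n"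
    have "x + y = n - z" using sum by simp
    moreover have "n - z \<in> {0<..<n}" using sym[OF mem(3)] range by blast
    ultimately have "(x + y) mod n = n - z"
      by (metis greaterThanLessThan_iff less_imp_le mod_pos_pos_trivial)
    then show False using free mem sym by metis
  next
    fix x y
    assume no: "\<forall>x\<in>R. \<forall>y\<in>R. \<forall>z\<in>R. x + y + z \<noteq> n"
      and mem: "x \<in> R" "y \<in> R" "(x + y) mod n \<in> R"
    have bounds: "0 < x" "x < n" "0 < y" "y < n" using mem range by auto
    show False
    proof (cases "x + y < n")
      case True
      then have "x + y \<in> R" using mem bounds by simp
      then have "n - (x + y) \<in> R" by (rule sym)
      then show False using no mem by force
    next
      case False
      have "(x + y) mod n = (x + y - n) mod n" by simp
      also have "\<dots> = x + y - n" using False bounds by (intro mod_pos_pos_trivial) auto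
      finally have "x + y - n \<in> R" using mem by simp
      moreover have "n - x \<in> R" "n - y \<in> R" using mem sym by auto
      ultimately show False using no by force
    qed
  qed
  finally show ?thesis .
qed

lemma residues_of_eq_self:
  assumes "A \<subseteq> {0..<n}"
  shows "residues_of n A = A"
  using assms by (force simp: residues_of_def)

lemma plus_minus_integer_mod_group:
  fixes n :: int
  assumes "A \<subseteq> {0<..<n}"
  shows "plus_minus (integer_mod_group (nat n)) A = A \<union> (\<lambda>x. n - x) ` A"
proof -
  have "inv\<^bsub>integer_mod_group (nat n)\<^esub> x = n - x" if "x \<in> A" for x
  proof -
    have x: "0 < x" "x < n" using assms that by auto
    then have "inv\<^bsub>integer_mod_group (nat n)\<^esub> x = (- x) mod n"
      by (subst inv_integer_mod_group) (auto simp: carrier_integer_mod_group)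
    also have "\<dots> = n - x" using x by (simp add: zmod_zminus1_eq_if)
    finally show ?thesis .
  qed
  then show ?thesis by (auto simp: plus_minus_def SET_INV_def)
qed

lemma S_set_eq_representatives:
  fixes n s t :: int and T :: "int set"
  assumes "2 * t = n - 3 * s + 1" and "t > 0" and "n \<le> 4 * s - 3" and "T \<subseteq> {0..2 * t - 1}"
  shows "S_set n s T = {n - 2 * s + 1..2 * s - 1} \<union> (s +o T) \<union> (\<lambda>x. n - x) ` (s +o T)"
proof -
  have T: "s +o T \<subseteq> {0<..<n}" using assms by (fastforce simp: elt_set_plus_def)
  then have "s +o T \<subseteq> {0..<n}" by fastforce
  moreover have "{n - 2 * s + 1..2 * s - 1} \<subseteq> {0..<n}" using assms by auto
  ultimately show ?thesis
    by (simp add: S_set_def residues_of_eq_self plus_minus_integer_mod_group[OF T] Un_assoc)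
qed

theorem lemma3p2:
  fixes n s t :: int and T :: "int set"
  assumes "2 * t = n - 3 * s + 1"
    and "t > 0"
    and "n \<le> 4 * s - 3"
    and "T \<subseteq> {0..2 * t - 1}"
  shows "sum_free (integer_mod_group (nat n)) (S_set n s T) \<longleftrightarrow> 2 * t - 1 \<notin> T + T + T"
proof -
  define R where "R = S_set n s T"
  note R_eq = S_set_eq_representatives[OF assms, folded R_def]
  have T: "s \<le> u \<and> u \<le> n - 2 * s" if "u \<in> s +o T" for u
    using that assms by (fastforce simp: elt_set_plus_def)
  have R: "s \<le> x \<and> x \<le> n - s" if "x \<in> R" for x
    using that assms(1-3) unfolding R_eq by (auto dest: T)
  then have "R \<subseteq> {0<..<n}" using assms(1-3) by fastforce
  moreover have "n - x \<in> R" if "x \<in> R" for x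
    using that unfolding R_eq by auto
  ultimately have "sum_free (integer_mod_group (nat n)) R
      \<longleftrightarrow> (\<forall>x\<in>R. \<forall>y\<in>R. \<forall>z\<in>R. x + y + z \<noteq> n)"
    by (rule sum_free_symmetric_iff)
  also have "\<dots> \<longleftrightarrow> (\<forall>x\<in>s +o T. \<forall>y\<in>s +o T. \<forall>z\<in>s +o T. x + y + z \<noteq> n)"
  proof -
    \<comment> \<open>Both the middle interval and the reflection of \<open>s + T\<close> lie above \<open>n - 2s\<close>.\<close>
    have small: "x \<in> s +o T" if "x \<in> R" "x \<le> n - 2 * s" for x
      using that assms(3) unfolding R_eq by (auto dest: T)
    have "x \<in> s +o T \<and> y \<in> s +o T \<and> z \<in> s +o T"
      if "x \<in> R" "y \<in> R" "z \<in> R" "x + y + z = n" for x y z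
      using that R[of x] R[of y] R[of z] by (intro conjI small) auto
    moreover have "s +o T \<subseteq> R" unfolding R_eq by auto
    ultimately show ?thesis by blast
  qed
  also have "\<dots> \<longleftrightarrow> (\<forall>a\<in>T. \<forall>b\<in>T. \<forall>c\<in>T. a + b + c \<noteq> 2 * t - 1)"
  proof -
    have "(s + a) + (s + b) + (s + c) = n \<longleftrightarrow> a + b + c = 2 * t - 1" for a b c
      using assms(1) by auto
    moreover have "s +o T = (\<lambda>a. s + a) ` T" by (auto simp: elt_set_plus_def)
    ultimately show ?thesis by (simp only: ball_simps)
  qed
  also have "\<dots> \<longleftrightarrow> 2 * t - 1 \<notin> T + T + T"
    unfolding set_plus_def Ball_def Bex_def mem_Collect_eq by metis
  finally show ?thesis unfolding R_def .
qed

end
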